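(* For each $k\in\{0,1,2,\dots\}$ there exist polynomials $Q_{k,j}\in\mathbb{Q}[x]$, $-k\le j\le 2k$, such that $$M(i^k;n):=\sum_{\lambda\in\Pi(n)}i(\lambda)^k=Q_{k,2k}(n)B_{n+2k}+\dots+Q_{k,0}(n)B_n+\dots+Q_{k,-k}(n)B_{n-k},$$ where the degree of $Q_{k,2k-j}$ is bounded by $j$. For example, $$M(i;n)=\tfrac14\big((2n+1)B_n+(2n+9)B_{n+1}-5B_{n+2}\big),$$ $$M(i^2;n)=\tfrac{1}{144}\big((36n^2+24n-23)B_n+(72n^2+72n-260)B_{n+1}+(36n^2+156n+489)B_{n+2}-(180n+814)B_{n+3}+225B_{n+4}\big).$$
   Context: $\Pi(n)$ is the set of set partitions of $[n]=\{1,\dots,n\}$ and $B_n=|\Pi(n)|$ is the $n$th Bell number (with $B_m$ for negative $m$ not needed when $n\ge k$). For $\lambda\in\Pi(n)$, $\mathbf{Arc}(\lambda)$ is the set of pairs $(e,f)$ with $e<f$ in the same block of $\lambda$ and no element of that block strictly between them. The intertwining exponent (number of 2-crossings) is $i(\lambda)=\#\{((e_1,f_1),(e_2,f_2))\in\mathbf{Arc}(\lambda)^2: e_1<e_2<f_1<f_2\}$. *)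

theory Defs
  imports Complex_Main "HOL-Library.Disjoint_Sets" "HOL-Computational_Algebra.Polynomial"
begin

definition set_partitions :: "nat \<Rightarrow> nat set set set" where
  "set_partitions n = {P. partition_on {1..n} P}"

definition bell :: "nat \<Rightarrow> nat" where
  "bell n = card (set_partitions n)"

definition arcs :: "nat set set \<Rightarrow> (nat \<times> nat) set" where
  "arcs P = {(e, f). e < f \<and> (\<exists>b\<in>P. e \<in> b \<and> f \<in> b \<and> \<not> (\<exists>g\<in>b. e < g \<and> g < f))}"

definition intertwining :: "nat set set \<Rightarrow> nat" where
  "intertwining P =
     card {((e1, f1), (e2, f2)). (e1, f1) \<in> arcs P \<and> (e2, f2) \<in> arcs P \<and>
                                 e1 < e2 \<and> e2 < f1 \<and> f1 < f2}"

definition intertwining_moment :: "nat \<Rightarrow> nat \<Rightarrow> nat" where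
  "intertwining_moment k n = (\<Sum>P\<in>set_partitions n. intertwining P ^ k)"

end

theory Submission
  imports Defs
begin

text \<open>
  Read a partition from left to right and keep track of the blocks that are still open. If \<open>h\<close> blocks
  are open, attaching the next element to one of them creates \<open>0, \<dots>, h - 1\<close> new crossings, depending
  on the block. With \<open>z\<close> marking open blocks and \<open>D = d/dz\<close>, the generating polynomials \<open>F\<^sub>k(n)\<close> of the
  binomial moments \<open>i choose k\<close> therefore satisfy
  \<open>F\<^sub>k(n+1) = (1+z) (F\<^sub>k(n) + \<Sum>\<^sub>j z\<^sup>j D\<^sup>j\<^sup>+\<^sup>1 F\<^bsub>k-j\<^esub>(n) / (j+1)!)\<close>.

  Put \<open>W = 1 + z\<close>, \<open>E = 1 + D\<close>, \<open>T = W E\<close>. Then \<open>F\<^sub>0(n) = T\<^sup>n 1\<close> takes the value \<open>B\<^sub>n\<close> at \<open>z = 0\<close>, and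
  \<open>F\<^sub>k\<close> solves \<open>F\<^sub>k(n+1) = T F\<^sub>k(n) + \<dots>\<close> with an inhomogeneity of lower order. Since
  \<open>T W\<^sup>p E\<^sup>r = W\<^sup>p E\<^sup>r (T + p - r)\<close>, the recurrence can be solved in the span of the functions
  \<open>(n choose s) W\<^sup>p E\<^sup>r T\<^bsup>n-s\<^esup> 1\<close>, each order raising \<open>s\<close> by at most one and \<open>p\<close>, \<open>r\<close> by at most two. At
  \<open>z = 0\<close> the operator \<open>E\<^sup>r\<close> acts like \<open>W\<^sup>r E\<^sup>r = T (T - 1) \<dots> (T - r + 1)\<close>, so one gets a combination of
  \<open>(n choose s) B\<^bsub>n-s+i\<^esub>\<close> with \<open>s \<le> k\<close> and \<open>i \<le> 2k\<close>.
\<close>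

section \<open>Crossings and open blocks\<close>

text \<open>In \<open>crossings X Y\<close> the elements of \<open>Y\<close> are left endpoints of arcs that are not yet closed:
  such an arc will cross \<open>(e, f)\<close> wherever it ends, as soon as it starts strictly between \<open>e\<close>
  and \<open>f\<close>.\<close>

definition crossings :: "(nat \<times> nat) set \<Rightarrow> nat set \<Rightarrow> nat" where
  "crossings X Y =
     card {((e1, f1), (e2, f2)). (e1, f1) \<in> X \<and> (e2, f2) \<in> X \<and> e1 < e2 \<and> e2 < f1 \<and> f1 < f2} +
     card {((e, f), y). (e, f) \<in> X \<and> y \<in> Y \<and> e < y \<and> y < f}"

lemma crossings_arcs_empty: "crossings (arcs P) {} = intertwining P"
  by (auto simp: crossings_def intertwining_def card_eq_0_iff)

text \<open>No arc of \<open>X\<close> ends beyond \<open>m\<close>, so an open arc starting at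
  \<open>m\<close> lies under none of them. Leaving the block of the newest element open is
  therefore free.\<close>

lemma crossings_insert_open:
  assumes "X \<subseteq> UNIV \<times> {..m}"
  shows "crossings X (insert m Y) = crossings X Y"
proof -
  have "{((e, f), y). (e, f) \<in> X \<and> y \<in> insert m Y \<and> e < y \<and> y < f}
      = {((e, f), y). (e, f) \<in> X \<and> y \<in> Y \<and> e < y \<and> y < f}"
    using assms by auto
  then show ?thesis by (simp add: crossings_def)
qed

text \<open>Closed arcs around \<open>y\<close>, previously paired with the open start
  \<open>y\<close>, now cross \<open>(y, m)\<close> and merely move from the second count to the
  first. The gain comes from the open starts after \<open>y\<close>, which now lie under
  \<open>(y, m)\<close>.\<close>

lemma crossings_close:
  assumes "finite X" "finite Y" "X \<subseteq> {..<m} \<times> {..<m}" "Y \<subseteq> {..<m}" "y \<in> Y"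
  shows "crossings (insert (y, m) X) (Y - {y}) = crossings X Y + card {y' \<in> Y. y < y'}"
proof -
  let ?C = "\<lambda>X. {((e1, f1), (e2, f2)). (e1, f1) \<in> X \<and> (e2, f2) \<in> X \<and> e1 < e2 \<and> e2 < f1 \<and> f1 < f2}"
  let ?D = "\<lambda>X Y. {((e, f), y). (e, f) \<in> X \<and> y \<in> Y \<and> e < y \<and> y < f}"
  let ?A = "{a \<in> X. fst a < y \<and> y < snd a}"
  have fin: "finite (?C X)" "finite (?D X (Y - {y}))" "finite ?A"
    by (rule finite_subset[of _ "X \<times> X"], use assms in auto)
       (rule finite_subset[of _ "X \<times> Y"], use assms in auto)
  have "?C (insert (y, m) X) = ?C X \<union> (\<lambda>a. (a, (y, m))) ` ?A"
    using assms by (fastforce simp: image_iff)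
  moreover have "?C X \<inter> (\<lambda>a. (a, (y, m))) ` ?A = {}"
    using assms by auto
  ultimately have 1: "card (?C (insert (y, m) X)) = card (?C X) + card ?A"
    using fin by (simp add: card_Un_disjoint card_image inj_on_def)
  have "?D (insert (y, m) X) (Y - {y}) = ?D X (Y - {y}) \<union> (\<lambda>y'. ((y, m), y')) ` {y' \<in> Y. y < y'}"
    using assms by (auto simp: image_iff)
  moreover have "?D X (Y - {y}) \<inter> (\<lambda>y'. ((y, m), y')) ` {y' \<in> Y. y < y'} = {}"
    using assms by auto
  ultimately have 2: "card (?D (insert (y, m) X) (Y - {y})) = card (?D X (Y - {y})) + card {y' \<in> Y. y < y'}"
    using fin assms by (simp add: card_Un_disjoint card_image inj_on_def)
  have "?D X Y = ?D X (Y - {y}) \<union> (\<lambda>a. (a, y)) ` ?A"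
    using assms by (auto simp: image_iff)
  moreover have "?D X (Y - {y}) \<inter> (\<lambda>a. (a, y)) ` ?A = {}"
    by auto
  ultimately have 3: "card (?D X Y) = card (?D X (Y - {y})) + card ?A"
    using fin by (simp add: card_Un_disjoint card_image inj_on_def)
  show ?thesis
    unfolding crossings_def using 1 2 3 by simp
qed

section \<open>Set partitions and removal of the largest element\<close>

lemma set_partitionsD:
  assumes "P \<in> set_partitions n"
  shows "finite P" "\<Union>P = {1..n}" "{} \<notin> P" "\<And>b. b \<in> P \<Longrightarrow> finite b \<and> b \<subseteq> {1..n}"
    "\<And>b c x. b \<in> P \<Longrightarrow> c \<in> P \<Longrightarrow> x \<in> b \<Longrightarrow> x \<in> c \<Longrightarrow> b = c"
proof -
  have P: "partition_on {1..n} P" using assms by (simp add: set_partitions_def)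
  show "finite P" using P finite_elements by blast
  show U: "\<Union>P = {1..n}" using partition_onD1[OF P] by simp
  show "{} \<notin> P" using partition_onD3[OF P] .
  show "finite b \<and> b \<subseteq> {1..n}" if "b \<in> P" for b
  proof -
    have "b \<subseteq> {1..n}" using U that by blast
    then show ?thesis using finite_subset by blast
  qed
  show "b = c" if "b \<in> P" "c \<in> P" "x \<in> b" "x \<in> c" for b c x
    using partition_onD2[OF P] that unfolding disjoint_def by blast
qed

lemma finite_set_partitions: "finite (set_partitions n)"
  by (simp add: set_partitions_def finitely_many_partition_on)

lemma set_partitions_0: "set_partitions 0 = {{}}"
  by (simp add: set_partitions_def partition_on_empty)

lemma set_partitions_extend:
  assumes P: "P \<in> set_partitions n" and b: "b \<in> insert {} P"
  shows "insert (insert (Suc n) b) (P - {b}) \<in> set_partitions (Suc n)"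
proof -
  note D = set_partitionsD[OF P]
  have U: "\<Union>(P - {b}) = {1..n} - b"
  proof
    show "\<Union>(P - {b}) \<subseteq> {1..n} - b" using D(2,5) b by auto
    show "{1..n} - b \<subseteq> \<Union>(P - {b})" using D(2) by blast
  qed
  have bn: "b \<subseteq> {1..n}" using b D(4) by auto
  have "partition_on ({1..n} - b) (P - {b})"
  proof (rule partition_onI)
    show "disjnt p q" if "p \<in> P - {b}" "q \<in> P - {b}" "p \<noteq> q" for p q
      using D(5)[of p q] that by (auto simp: disjnt_iff)
  qed (use U D(3) in auto)
  moreover have "{1..Suc n} - insert (Suc n) b = {1..n} - b" by auto
  moreover have "disjnt (insert (Suc n) b) (\<Union>(P - {b}))"
    unfolding U by (auto simp: disjnt_iff)
  moreover have "insert (Suc n) b \<subseteq> {1..Suc n}" using bn by auto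
  ultimately show ?thesis
    unfolding set_partitions_def by (simp add: partition_on_insert)
qed

text \<open>Discarding \<open>{}\<close> treats uniformly the case in which \<open>Suc n\<close>
  forms a block of its own.\<close>

lemma set_partitions_remove:
  assumes Q: "Q \<in> set_partitions (Suc n)" and c: "c \<in> Q" "Suc n \<in> c"
  shows "(Q - {c}) \<union> ({c - {Suc n}} - {{}}) \<in> set_partitions n"
proof -
  note D = set_partitionsD[OF Q]
  have U: "\<Union>((Q - {c}) \<union> ({c - {Suc n}} - {{}})) = {1..n}" (is "?L = _")
  proof
    show "?L \<subseteq> {1..n}"
    proof
      fix x assume x: "x \<in> ?L"
      have "x \<in> {1..Suc n}" using D(2) x c by blast
      moreover have "x \<noteq> Suc n" using x c D(5) by auto
      ultimately show "x \<in> {1..n}" by auto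
    qed
    show "{1..n} \<subseteq> ?L"
    proof
      fix x assume x: "x \<in> {1..n}"
      then obtain d where "d \<in> Q" "x \<in> d" using D(2) by (metis UnionE atLeastAtMost_iff le_SucI)
      then show "x \<in> ?L" using x by (cases "d = c") auto
    qed
  qed
  have "partition_on {1..n} ((Q - {c}) \<union> ({c - {Suc n}} - {{}}))"
  proof (rule partition_onI[OF U])
    fix p q
    assume p: "p \<in> (Q - {c}) \<union> ({c - {Suc n}} - {{}})"
      and q: "q \<in> (Q - {c}) \<union> ({c - {Suc n}} - {{}})" and "p \<noteq> q"
    have "disjnt d c" "disjnt c d" if "d \<in> Q - {c}" for d
      using D(5)[of d c] that c by (auto simp: disjnt_iff)
    moreover have "disjnt p q" if "p \<in> Q" "q \<in> Q"
      using D(5)[of p q] that \<open>p \<noteq> q\<close> by (auto simp: disjnt_iff)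
    ultimately show "disjnt p q"
      using p q \<open>p \<noteq> q\<close> by (auto simp: disjnt_iff)
  qed (use D(3) in auto)
  then show ?thesis by (simp add: set_partitions_def)
qed

text \<open>Deleting \<open>Suc n\<close> from its block is reversible once the remainder
  \<open>b\<close> of that block is recorded.\<close>

lemma sum_set_partitions_Suc:
  fixes g :: "nat set set \<Rightarrow> 'a::comm_monoid_add"
  shows "(\<Sum>Q\<in>set_partitions (Suc n). g Q) =
    (\<Sum>P\<in>set_partitions n. \<Sum>b\<in>insert {} P. g (insert (insert (Suc n) b) (P - {b})))"
proof -
  define blk where "blk Q = (THE c. c \<in> Q \<and> Suc n \<in> c)" for Q :: "nat set set"
  have blkI: "blk Q = c" if "Q \<in> set_partitions (Suc n)" "c \<in> Q" "Suc n \<in> c" for Q c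
    unfolding blk_def
  proof (rule the_equality)
    show "d = c" if "d \<in> Q \<and> Suc n \<in> d" for d
      using set_partitionsD(5)[OF \<open>Q \<in> _\<close>, of d c "Suc n"] \<open>c \<in> Q\<close> \<open>Suc n \<in> c\<close> that by simp
  qed (use that in simp)
  have blk: "blk Q \<in> Q \<and> Suc n \<in> blk Q" if Q: "Q \<in> set_partitions (Suc n)" for Q
  proof -
    have "Suc n \<in> \<Union>Q" using set_partitionsD(2)[OF Q] by simp
    then show ?thesis using blkI[OF Q] by auto
  qed
  \<comment> \<open>\<open>b = {}\<close> stands for the new singleton block.\<close>
  let ?S = "SIGMA P:set_partitions n. insert {} P"
  have "(\<Sum>Q\<in>set_partitions (Suc n). g Q) = (\<Sum>(P, b)\<in>?S. g (insert (insert (Suc n) b) (P - {b})))"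
  proof (rule sum.reindex_bij_witness[where
        i = "\<lambda>(P, b). insert (insert (Suc n) b) (P - {b})" and
        j = "\<lambda>Q. ((Q - {blk Q}) \<union> ({blk Q - {Suc n}} - {{}}), blk Q - {Suc n})"])
    fix Q assume Q: "Q \<in> set_partitions (Suc n)"
    note D = set_partitionsD[OF Q] and B = blk[OF Q]
    \<comment> \<open>The remainder is not already another block of \<open>Q\<close>, so removing it
      from the smaller partition takes away nothing else.\<close>
    have ne: "blk Q - {Suc n} \<notin> Q - {blk Q}"
    proof
      assume *: "blk Q - {Suc n} \<in> Q - {blk Q}"
      then have "blk Q - {Suc n} \<noteq> {}" using D(3) by (metis DiffD1)
      then obtain x where "x \<in> blk Q - {Suc n}" by blast
      then show False using * B D(5)[of "blk Q - {Suc n}" "blk Q" x] by auto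
    qed
    have i: "insert (Suc n) (blk Q - {Suc n}) = blk Q" using B by auto
    have "insert (blk Q) ((Q - {blk Q}) \<union> ({blk Q - {Suc n}} - {{}}) - {blk Q - {Suc n}}) = Q"
      using ne B by blast
    then show *: "(case ((Q - {blk Q}) \<union> ({blk Q - {Suc n}} - {{}}), blk Q - {Suc n}) of
        (P, b) \<Rightarrow> insert (insert (Suc n) b) (P - {b})) = Q"
      by (simp only: prod.case i)
    show "((Q - {blk Q}) \<union> ({blk Q - {Suc n}} - {{}}), blk Q - {Suc n}) \<in> ?S"
      using set_partitions_remove[OF Q] B by auto
    show "(case ((Q - {blk Q}) \<union> ({blk Q - {Suc n}} - {{}}), blk Q - {Suc n}) of
        (P, b) \<Rightarrow> g (insert (insert (Suc n) b) (P - {b}))) = g Q"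
      using * by simp
  next
    fix a assume a: "a \<in> ?S"
    obtain P b where ab: "a = (P, b)" "P \<in> set_partitions n" "b \<in> insert {} P"
      using a by auto
    let ?Q = "insert (insert (Suc n) b) (P - {b})"
    note D = set_partitionsD[OF ab(2)]
    have Q: "?Q \<in> set_partitions (Suc n)" by (rule set_partitions_extend[OF ab(2,3)])
    have nb: "Suc n \<notin> c" if "c \<in> insert {} P" for c
    proof
      assume "Suc n \<in> c"
      then have "Suc n \<in> {1..n}" using D(4)[of c] that by blast
      then show False by simp
    qed
    have e: "blk ?Q = insert (Suc n) b" by (rule blkI[OF Q]) simp_all
    have "insert (Suc n) b - {Suc n} = b" using nb[OF ab(3)] by auto
    moreover have "?Q - {insert (Suc n) b} = P - {b}" using nb[of "insert (Suc n) b"] by blast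
    moreover have "(P - {b}) \<union> ({b} - {{}}) = P" using ab(3) D(3) by blast
    ultimately show "(\<lambda>Q. ((Q - {blk Q}) \<union> ({blk Q - {Suc n}} - {{}}), blk Q - {Suc n}))
        (case a of (P, b) \<Rightarrow> insert (insert (Suc n) b) (P - {b})) = a"
      by (simp only: ab(1) prod.case e)
    show "(case a of (P, b) \<Rightarrow> insert (insert (Suc n) b) (P - {b})) \<in> set_partitions (Suc n)"
      using Q ab by simp
  qed
  also have "\<dots> = (\<Sum>P\<in>set_partitions n. \<Sum>b\<in>insert {} P. g (insert (insert (Suc n) b) (P - {b})))"
    by (rule sum.Sigma[symmetric]) (auto simp: finite_set_partitions set_partitionsD(1))
  finally show ?thesis .
qed

section \<open>Sums over open blocks, and the arcs created by a new element\<close>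

lemma sum_Pow_insert:
  fixes h :: "'b set \<Rightarrow> 'a::comm_monoid_add"
  assumes "finite A" "a \<notin> A"
  shows "(\<Sum>B\<in>Pow (insert a A). h B) = (\<Sum>B\<in>Pow A. h B + h (insert a B))"
proof -
  have "inj_on (insert a) (Pow A)" using assms(2) by (auto simp: inj_on_def)
  moreover have "Pow A \<inter> insert a ` Pow A = {}" using assms(2) by auto
  ultimately show ?thesis
    using assms(1) by (simp add: Pow_insert sum.union_disjoint sum.reindex sum.distrib)
qed

text \<open>Used to exchange two orders of choice: the block to be extended first and the other open
  blocks later, or all open blocks first and then one of them.\<close>

lemma sum_remove_Pow:
  fixes h :: "'b \<Rightarrow> 'b set \<Rightarrow> 'a::comm_monoid_add"
  assumes "finite A"
  shows "(\<Sum>b\<in>A. \<Sum>B\<in>Pow (A - {b}). h b B) = (\<Sum>B\<in>Pow A. \<Sum>b\<in>B. h b (B - {b}))"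
proof -
  have "(\<Sum>b\<in>A. \<Sum>B\<in>Pow (A - {b}). h b B) = (\<Sum>(b, B)\<in>(SIGMA b:A. Pow (A - {b})). h b B)"
    using assms by (intro sum.Sigma) auto
  also have "\<dots> = (\<Sum>(B, b)\<in>(SIGMA B:Pow A. B). h b (B - {b}))"
    by (rule sum.reindex_bij_witness[where i = "\<lambda>(B, b). (b, B - {b})" and j = "\<lambda>(b, B). (insert b B, b)"])
       (auto simp: insert_absorb subset_Diff_insert)
  also have "\<dots> = (\<Sum>B\<in>Pow A. \<Sum>b\<in>B. h b (B - {b}))"
    using assms by (intro sum.Sigma[symmetric]) (auto intro: finite_subset)
  finally show ?thesis .
qed

lemma arcs_insert_singleton: "arcs (insert {m} P) = arcs P"
  by (auto simp: arcs_def)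

text \<open>The new element exceeds everything in \<open>b\<close>, so its only neighbour in the
  enlarged block is \<open>Max b\<close>, and no earlier arc is broken.\<close>

lemma arcs_extend_block:
  assumes P: "P \<in> set_partitions n" and b: "b \<in> P"
  shows "arcs (insert (insert (Suc n) b) (P - {b})) = insert (Max b, Suc n) (arcs P)"
proof -
  note D = set_partitionsD[OF P]
  have bn: "finite b" "b \<subseteq> {1..n}" "b \<noteq> {}" using D(3,4) b by auto
  have M: "Max b \<in> b" "\<And>x. x \<in> b \<Longrightarrow> x \<le> Max b" using bn by auto
  have lt: "x \<le> n" if "x \<in> b" for x using bn that by auto
  define gap where "gap c e f \<longleftrightarrow> e < f \<and> e \<in> c \<and> f \<in> c \<and> \<not> (\<exists>g\<in>c. e < g \<and> g < f)"
    for c :: "nat set" and e f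
  have arcs: "(e, f) \<in> arcs Q \<longleftrightarrow> (\<exists>c\<in>Q. gap c e f)" for Q e f
    by (auto simp: arcs_def gap_def)
  have "gap (insert (Suc n) b) e f \<longleftrightarrow> gap b e f \<or> (e = Max b \<and> f = Suc n)" for e f
  proof
    assume g: "gap (insert (Suc n) b) e f"
    show "gap b e f \<or> (e = Max b \<and> f = Suc n)"
    proof (cases "f = Suc n")
      case True
      then have "e \<in> b" using g by (auto simp: gap_def)
      moreover have "\<not> e < Max b" using g True M(1) lt[OF M(1)] by (auto simp: gap_def)
      ultimately show ?thesis using M(2)[of e] True by auto
    next
      case False
      then have "f \<in> b" using g by (auto simp: gap_def)
      then have "e \<noteq> Suc n" using g lt[of f] by (auto simp: gap_def)
      then show ?thesis using g False by (auto simp: gap_def)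
    qed
  next
    assume "gap b e f \<or> (e = Max b \<and> f = Suc n)"
    then show "gap (insert (Suc n) b) e f"
    proof
      assume "gap b e f"
      then show ?thesis using lt[of f] by (auto simp: gap_def)
    next
      assume "e = Max b \<and> f = Suc n"
      then show ?thesis using M lt[OF M(1)] by (auto simp: gap_def leD)
    qed
  qed
  then have "(e, f) \<in> arcs (insert (insert (Suc n) b) (P - {b})) \<longleftrightarrow>
      (e, f) \<in> insert (Max b, Suc n) (arcs P)" for e f
    using b by (auto simp: arcs)
  then show ?thesis by auto
qed

lemma arcs_subset:
  assumes "P \<in> set_partitions n"
  shows "arcs P \<subseteq> {..<Suc n} \<times> {..<Suc n}"
proof clarify
  fix e f assume "(e, f) \<in> arcs P"
  then obtain b where "b \<in> P" "e \<in> b" "f \<in> b" by (auto simp: arcs_def)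
  then have "e \<in> {1..n}" "f \<in> {1..n}" using set_partitionsD(4)[OF assms, of b] by blast+
  then show "e \<in> {..<Suc n} \<and> f \<in> {..<Suc n}" by auto
qed

lemma finite_arcs: "P \<in> set_partitions n \<Longrightarrow> finite (arcs P)"
  using arcs_subset finite_subset by blast

text \<open>Counting the elements above \<open>y\<close> ranks \<open>Y\<close> from the top, and
  each rank occurs once. Applied to the maxima of the open blocks, this lists the numbers of
  crossings that the choices of a block create.\<close>

lemma sum_card_greater:
  fixes Y :: "'b::linorder set" and g :: "nat \<Rightarrow> 'a::comm_monoid_add"
  assumes "finite Y"
  shows "(\<Sum>y\<in>Y. g (card {y' \<in> Y. y < y'})) = (\<Sum>r<card Y. g r)"
  using assms
proof (induction rule: finite_linorder_min_induct)
  case empty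
  then show ?case by simp
next
  case (insert b A)
  then have nb: "b \<notin> A" by auto
  have "{y' \<in> insert b A. b < y'} = A" using insert by auto
  moreover have "(\<Sum>y\<in>A. g (card {y' \<in> insert b A. y < y'})) = (\<Sum>y\<in>A. g (card {y' \<in> A. y < y'}))"
  proof (rule sum.cong)
    fix y assume "y \<in> A"
    then have "{y' \<in> insert b A. y < y'} = {y' \<in> A. y < y'}" using insert by auto
    then show "g (card {y' \<in> insert b A. y < y'}) = g (card {y' \<in> A. y < y'})" by simp
  qed simp
  ultimately show ?case using insert nb by (simp add: add.commute)
qed

section \<open>Generating polynomials of the binomial moments\<close>

text \<open>The blocks in \<open>B\<close> are those that will receive further elements.\<close>

definition moment_poly :: "nat \<Rightarrow> nat \<Rightarrow> rat poly" where
  "moment_poly k n = (\<Sum>P\<in>set_partitions n. \<Sum>B\<in>Pow P.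
     monom (of_nat (crossings (arcs P) (Max ` B) choose k)) (card B))"

lemma sum_choose_shift:
  "(\<Sum>r<h. (c + r) choose k) = (\<Sum>j\<le>k. (c choose (k - j)) * (h choose Suc j))"
proof -
  \<comment> \<open>The hockey-stick identity; it is combined with Vandermonde's convolution for
    \<open>(c + r) choose k\<close>.\<close>
  have hs: "(\<Sum>r<h. r choose j) = h choose Suc j" for j
    by (induction h) auto
  have "(\<Sum>r<h. (c + r) choose k) = (\<Sum>r<h. \<Sum>j\<le>k. (r choose j) * (c choose (k - j)))"
    by (simp add: vandermonde add.commute)
  also have "\<dots> = (\<Sum>j\<le>k. \<Sum>r<h. (r choose j) * (c choose (k - j)))"
    by (rule sum.swap)
  also have "\<dots> = (\<Sum>j\<le>k. (c choose (k - j)) * (h choose Suc j))"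
    by (simp add: hs sum_distrib_right[symmetric] mult.commute)
  finally show ?thesis .
qed

text \<open>Taking \<open>Suc j\<close> derivatives of \<open>z^h\<close> lowers the degree by
  \<open>j + 1\<close>, and the factor \<open>z^j\<close> brings it back to \<open>h - 1\<close>.
  For \<open>h <= j\<close> both sides vanish.\<close>

lemma monom_choose_eq_higher_pderiv:
  "monom (a * of_nat (h choose Suc j)) (h - 1) =
     smult (1 / fact (Suc j)) (monom 1 j * (pderiv ^^ Suc j) (monom (a::rat) h))"
proof (rule poly_eqI)
  fix i
  show "coeff (monom (a * of_nat (h choose Suc j)) (h - 1)) i =
    coeff (smult (1 / fact (Suc j)) (monom 1 j * (pderiv ^^ Suc j) (monom a h))) i"
  proof (cases "h = Suc i \<and> j \<le> i")
    case True
    have "pochhammer (of_nat (Suc (i - j))) (Suc j) = (fact (Suc j) * of_nat (Suc i choose Suc j) :: rat)"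
    proof -
      have "Suc (i - j) + Suc j - 1 = Suc i" using True by simp
      then have "of_nat (Suc i choose Suc j) = (of_nat (Suc i) gchoose Suc j :: rat)"
        by (simp only: binomial_gbinomial)
      also have "\<dots> = pochhammer (of_nat (Suc i) - of_nat (Suc j) + 1) (Suc j) / fact (Suc j)"
        by (rule gbinomial_pochhammer')
      also have "of_nat (Suc i) - of_nat (Suc j) + 1 = (of_nat (Suc (i - j)) :: rat)"
        using True by (simp add: of_nat_diff)
      finally show ?thesis by simp
    qed
    then show ?thesis using True
      by (simp add: coeff_monom_mult coeff_higher_pderiv del: funpow.simps of_nat_Suc fact_Suc binomial_Suc_Suc)
  next
    case False
    then show ?thesis
      by (auto simp: coeff_monom_mult coeff_higher_pderiv simp del: funpow.simps of_nat_Suc fact_Suc binomial_Suc_Suc)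
  qed
qed

lemma moment_poly_0: "moment_poly k 0 = (if k = 0 then 1 else 0)"
proof -
  have "crossings (arcs {}) {} = 0" by (auto simp: crossings_def arcs_def card_eq_0_iff)
  then show ?thesis
    by (cases k) (simp_all add: moment_poly_def set_partitions_0 monom_0 one_pCons)
qed

text \<open>The new element starts a block or joins an open one, which gives the two summands;
  joining the open block of rank \<open>r\<close> from the top adds \<open>r\<close> crossings. The
  factor \<open>[:1, 1:]\<close> records whether the resulting block stays open.\<close>

lemma moment_poly_Suc_aux:
  "moment_poly k (Suc n) = (\<Sum>P\<in>set_partitions n. \<Sum>B\<in>Pow P.
     [:1, 1:] * (monom (of_nat (crossings (arcs P) (Max ` B) choose k)) (card B) +
       (\<Sum>r<card B. monom (of_nat ((crossings (arcs P) (Max ` B) + r) choose k)) (card B - 1))))"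
proof -
  define f :: "nat set set \<Rightarrow> nat set set \<Rightarrow> rat poly"
    where "f P B = monom (of_nat (crossings (arcs P) (Max ` B) choose k)) (card B)" for P B
  have "(\<Sum>b\<in>insert {} P. sum (f (insert (insert (Suc n) b) (P - {b})))
            (Pow (insert (insert (Suc n) b) (P - {b})))) =
      (\<Sum>B\<in>Pow P. [:1, 1:] * (monom (of_nat (crossings (arcs P) (Max ` B) choose k)) (card B) +
       (\<Sum>r<card B. monom (of_nat ((crossings (arcs P) (Max ` B) + r) choose k)) (card B - 1))))"
    (is "?L = ?R") if P: "P \<in> set_partitions n" for P
  proof -
    note D = set_partitionsD[OF P]
    let ?ext = "\<lambda>b. insert (insert (Suc n) b) (P - {b})"
    have notin: "Suc n \<notin> c" if "c \<in> P" for c using D(4)[OF that] by (auto dest: subsetD)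
    have sub: "crossings (arcs Q) (insert (Suc n) Y) = crossings (arcs Q) Y" if "Q \<in> set_partitions (Suc n)" for Q Y
      using arcs_subset[OF that] by (intro crossings_insert_open) auto
    have pow: "sum (f (?ext b)) (Pow (?ext b)) =
        (\<Sum>B\<in>Pow (P - {b}). [:1, 1:] * monom (of_nat (crossings (arcs (?ext b)) (Max ` B) choose k)) (card B))"
      if b: "b \<in> insert {} P" for b
    proof -
      have new: "insert (Suc n) b \<notin> P - {b}" using notin by auto
      have Mx: "Max (insert (Suc n) b) = Suc n"
        using b D(4)[of b] by (intro Max_eqI) (auto simp: subset_iff le_SucI)
      \<comment> \<open>The two sets differ by the block of \<open>Suc n\<close>, which adds one
        power of \<open>z\<close> and, by \<open>sub\<close>, no crossing.\<close>
      have "f (?ext b) B + f (?ext b) (insert (insert (Suc n) b) B) =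
          [:1, 1:] * monom (of_nat (crossings (arcs (?ext b)) (Max ` B) choose k)) (card B)"
        if B: "B \<in> Pow (P - {b})" for B
      proof -
        have "finite B" using B D(1) by (auto intro: finite_subset)
        moreover have "insert (Suc n) b \<notin> B" using B new by blast
        ultimately show ?thesis
          using sub[OF set_partitions_extend[OF P b]] Mx
          by (simp add: f_def monom_Suc)
      qed
      then show ?thesis
        using sum_Pow_insert[OF _ new, of "f (?ext b)"] D(1) by simp
    qed
    have ext0: "?ext {} = insert {Suc n} P" using D(3) by auto
    have "?L = sum (f (?ext {})) (Pow (?ext {})) + (\<Sum>b\<in>P. sum (f (?ext b)) (Pow (?ext b)))"
      by (rule sum.insert[OF D(1,3)])
    also have "sum (f (?ext {})) (Pow (?ext {})) =
        (\<Sum>B\<in>Pow P. [:1, 1:] * monom (of_nat (crossings (arcs P) (Max ` B) choose k)) (card B))"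
      using pow[of "{}"] D(3) arcs_insert_singleton ext0 by simp
    also have "(\<Sum>b\<in>P. sum (f (?ext b)) (Pow (?ext b))) =
        (\<Sum>b\<in>P. \<Sum>B\<in>Pow (P - {b}). [:1, 1:] *
           monom (of_nat (crossings (insert (Max b, Suc n) (arcs P)) (Max ` B) choose k)) (card B))"
      by (rule sum.cong[OF refl]) (simp only: pow arcs_extend_block[OF P] insertI2)
    also have "\<dots> = (\<Sum>B\<in>Pow P. \<Sum>b\<in>B. [:1, 1:] *
           monom (of_nat (crossings (insert (Max b, Suc n) (arcs P)) (Max ` (B - {b})) choose k)) (card (B - {b})))"
      by (rule sum_remove_Pow[OF D(1)])
    also have "\<dots> = (\<Sum>B\<in>Pow P. [:1, 1:] *
       (\<Sum>r<card B. monom (of_nat ((crossings (arcs P) (Max ` B) + r) choose k)) (card B - 1)))"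
    proof (rule sum.cong)
      fix B assume B: "B \<in> Pow P"
      have finB: "finite B" using B D(1) by (auto intro: finite_subset)
      have Max_in: "Max b \<in> b" if "b \<in> P" for b
        using D(3) D(4)[OF that] that by (intro Max_in) auto
      \<comment> \<open>Disjoint blocks have distinct maxima, so open blocks can be identified with
        their open arcs.\<close>
      have inj: "inj_on Max B"
      proof (rule inj_onI)
        fix b c assume bc: "b \<in> B" "c \<in> B" "Max b = Max c"
        then have "b \<in> P" "c \<in> P" using B by auto
        then show "b = c" using Max_in[of b] Max_in[of c] bc(3) D(5)[of b c "Max b"] by simp
      qed
      have less: "Max ` B \<subseteq> {..<Suc n}"
      proof (rule image_subsetI)
        fix b assume "b \<in> B"
        then have "b \<in> P" using B by auto
        then have "Max b \<in> {1..n}" using Max_in D(4) by blast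
        then show "Max b \<in> {..<Suc n}" by simp
      qed
      have "crossings (insert (Max b, Suc n) (arcs P)) (Max ` (B - {b})) =
          crossings (arcs P) (Max ` B) + card {y' \<in> Max ` B. Max b < y'}" if b: "b \<in> B" for b
      proof -
        have "Max ` (B - {b}) = Max ` B - {Max b}"
          using inj b by (simp add: inj_on_image_set_diff[where C = B])
        then show ?thesis
          using crossings_close[OF finite_arcs[OF P] _ arcs_subset[OF P] less] finB b by simp
      qed
      then have "(\<Sum>b\<in>B. [:1, 1:] *
           monom (of_nat (crossings (insert (Max b, Suc n) (arcs P)) (Max ` (B - {b})) choose k) :: rat) (card (B - {b})))
         = (\<Sum>b\<in>B. [:1, 1:] * monom (of_nat ((crossings (arcs P) (Max ` B) +
              card {y' \<in> Max ` B. Max b < y'}) choose k)) (card B - 1))"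
        using finB by (intro sum.cong) simp_all
      also have "\<dots> = (\<Sum>y\<in>Max ` B. [:1, 1:] * monom (of_nat ((crossings (arcs P) (Max ` B) +
              card {y' \<in> Max ` B. y < y'}) choose k)) (card B - 1))"
        by (simp only: sum.reindex[OF inj] o_def)
      also have "\<dots> = (\<Sum>r<card B. [:1, 1:] * monom (of_nat ((crossings (arcs P) (Max ` B) + r) choose k)) (card B - 1))"
        using sum_card_greater[of "Max ` B" "\<lambda>r. [:1, 1:] * monom (of_nat ((crossings (arcs P) (Max ` B) + r) choose k) :: rat) (card B - 1)"]
          finB by (simp only: card_image[OF inj] finite_imageI)
      finally show "(\<Sum>b\<in>B. [:1, 1:] *
           monom (of_nat (crossings (insert (Max b, Suc n) (arcs P)) (Max ` (B - {b})) choose k) :: rat) (card (B - {b})))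
         = [:1, 1:] * (\<Sum>r<card B. monom (of_nat ((crossings (arcs P) (Max ` B) + r) choose k)) (card B - 1))"
        by (simp only: sum_distrib_left)
    qed simp
    finally show "?L = ?R" by (simp only: sum.distrib distrib_left)
  qed
  then have "(\<Sum>P\<in>set_partitions n. \<Sum>b\<in>insert {} P. sum (f (insert (insert (Suc n) b) (P - {b})))
            (Pow (insert (insert (Suc n) b) (P - {b})))) =
      (\<Sum>P\<in>set_partitions n. \<Sum>B\<in>Pow P. [:1, 1:] *
       (monom (of_nat (crossings (arcs P) (Max ` B) choose k)) (card B) +
       (\<Sum>r<card B. monom (of_nat ((crossings (arcs P) (Max ` B) + r) choose k)) (card B - 1))))"
    by (intro sum.cong refl)
  then show ?thesis
    by (simp only: moment_poly_def f_def[symmetric] sum_set_partitions_Suc)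
qed

text \<open>\<open>sum_choose_shift\<close> expands the sum over ranks and
  \<open>monom_choose_eq_higher_pderiv\<close> turns each term into a derivative; linearity then
  reassembles the polynomials of order \<open>k - j\<close>.\<close>

lemma moment_poly_Suc:
  "moment_poly k (Suc n) = [:1, 1:] * (moment_poly k n +
     (\<Sum>j\<le>k. smult (1 / fact (Suc j)) (monom 1 j * (pderiv ^^ Suc j) (moment_poly (k - j) n))))"
proof -
  have "(\<Sum>r<h. monom (of_nat ((c + r) choose k)) (h - 1)) =
     (\<Sum>j\<le>k. smult (1 / fact (Suc j)) (monom 1 j * (pderiv ^^ Suc j) (monom (of_nat (c choose (k - j)) :: rat) h)))" for h c
  proof -
    have "(\<Sum>r<h. monom (of_nat ((c + r) choose k)) (h - 1)) = (monom (of_nat (\<Sum>r<h. (c + r) choose k)) (h - 1) :: rat poly)"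
      by (simp add: monom_sum)
    also have "\<dots> = (\<Sum>j\<le>k. monom (of_nat (c choose (k - j)) * of_nat (h choose Suc j)) (h - 1))"
      by (simp only: sum_choose_shift of_nat_sum monom_sum of_nat_mult)
    finally show ?thesis by (simp only: monom_choose_eq_higher_pderiv)
  qed
  then have rank: "moment_poly k (Suc n) = [:1, 1:] * (moment_poly k n +
      (\<Sum>P\<in>set_partitions n. \<Sum>B\<in>Pow P. \<Sum>j\<le>k. smult (1 / fact (Suc j)) (monom 1 j *
        (pderiv ^^ Suc j) (monom (of_nat (crossings (arcs P) (Max ` B) choose (k - j))) (card B)))))"
    unfolding moment_poly_Suc_aux
    by (simp only: moment_poly_def sum_distrib_left[symmetric] sum.distrib)
  have smult_sum_right: "smult c (sum f A) = (\<Sum>x\<in>A. smult c (f x))" for c :: rat and f and A :: "'b set"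
    by (induction A rule: infinite_finite_induct) (simp_all add: smult_add_right)
  have "(\<Sum>P\<in>set_partitions n. \<Sum>B\<in>Pow P. \<Sum>j\<le>k. smult (1 / fact (Suc j)) (monom 1 j *
        (pderiv ^^ Suc j) (monom (of_nat (crossings (arcs P) (Max ` B) choose (k - j))) (card B)))) =
      (\<Sum>j\<le>k. smult (1 / fact (Suc j)) (monom 1 j * (pderiv ^^ Suc j) (moment_poly (k - j) n)))"
    by (simp only: moment_poly_def higher_pderiv_sum sum_distrib_left smult_sum_right sum.swap[of _ "{..k}"])
  then show ?thesis by (simp only: rank)
qed

text \<open>At 0 only the empty set of open blocks contributes.\<close>

lemma poly_moment_poly_0:
  "poly (moment_poly k n) 0 = (\<Sum>P\<in>set_partitions n. of_nat (intertwining P choose k))"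
proof -
  have "(\<Sum>B\<in>Pow P. poly (monom (of_nat (crossings (arcs P) (Max ` B) choose k)) (card B)) 0) =
      (of_nat (intertwining P choose k) :: rat)" if P: "P \<in> set_partitions n" for P
  proof -
    have fin: "finite P" using set_partitionsD(1)[OF P] .
    have "(\<Sum>B\<in>Pow P. poly (monom (of_nat (crossings (arcs P) (Max ` B) choose k)) (card B)) 0) =
        (\<Sum>B\<in>Pow P. if B = {} then of_nat (intertwining P choose k) else (0::rat))"
      using fin by (intro sum.cong) (auto simp: poly_monom crossings_arcs_empty power_0_left card_eq_0_iff dest: finite_subset)
    also have "\<dots> = of_nat (intertwining P choose k)"
      using fin by (simp add: sum.delta)
    finally show ?thesis .
  qed
  then show ?thesis by (simp add: moment_poly_def poly_sum)
qed

section \<open>The operator recurrence\<close>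

definition W :: "rat poly" where "W = [:1, 1:]"

text \<open>This is differentiation conjugated by the exponential,
  \<open>exp(-z) D exp(z)\<close>.\<close>

definition opE :: "rat poly \<Rightarrow> rat poly" where "opE f = f + pderiv f"

definition opT :: "rat poly \<Rightarrow> rat poly" where "opT f = W * opE f"

text \<open>For \<open>r = 0\<close> these are the Touchard polynomials in the variable
  \<open>1 + z\<close>.\<close>

definition touchard :: "nat \<Rightarrow> nat \<Rightarrow> rat poly" where "touchard r n = (opE ^^ r) ((opT ^^ n) 1)"

lemma pderiv_W [simp]: "pderiv W = 1"
  by (simp add: W_def pderiv_pCons one_pCons)

lemma poly_W_0 [simp]: "poly W 0 = 1"
  by (simp add: W_def)

lemma pderiv_eq: "pderiv f = opE f - f"
  by (simp add: opE_def)

lemma opE_linear: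
  "opE 0 = 0" "opE 1 = 1" "opE (- f) = - opE f" "opE (f + g) = opE f + opE g" "opE (f - g) = opE f - opE g" "opE (smult c f) = smult c (opE f)"
  by (simp_all add: opE_def pderiv_add pderiv_diff pderiv_minus pderiv_smult smult_add_right)

lemma opT_linear:
  "opT 0 = 0" "opT (- f) = - opT f" "opT (f + g) = opT f + opT g" "opT (f - g) = opT f - opT g" "opT (smult c f) = smult c (opT f)"
  by (simp_all add: opT_def opE_linear algebra_simps)

lemma opT_pow_linear:
  "(opT ^^ n) 0 = 0" "(opT ^^ n) (f + g) = (opT ^^ n) f + (opT ^^ n) g" "(opT ^^ n) (smult c f) = smult c ((opT ^^ n) f)"
  by (induction n) (simp_all add: opT_linear)

lemma opE_W_mult: "opE (W * f) = W * opE f + f"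
  by (simp add: opE_def pderiv_mult algebra_simps)

lemma opE_W_power_mult: "opE (W ^ p * f) = W ^ p * opE f + smult (of_nat p) (W ^ (p - 1) * f)"
proof (induction p)
  case (Suc p)
  have "opE (W ^ Suc p * f) = W * opE (W ^ p * f) + W ^ p * f"
    using opE_W_mult[of "W ^ p * f"] by (simp add: mult.assoc)
  also have "W * smult (of_nat p) (W ^ (p - 1) * f) = smult (of_nat p) (W ^ p * f)"
    by (cases p) (simp_all add: mult.assoc)
  then have "W * opE (W ^ p * f) = W ^ Suc p * opE f + smult (of_nat p) (W ^ p * f)"
    by (simp add: Suc.IH distrib_left mult.assoc)
  finally show ?case by (simp add: smult_add_left algebra_simps)
qed simp

text \<open>Iterating \<open>E W = W E + 1\<close> gives \<open>E^r W = W E^r + r E^(r-1)\<close>,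
  here applied to \<open>E f\<close>.\<close>

lemma opE_pow_opT: "(opE ^^ r) (opT f) = W * (opE ^^ Suc r) f + smult (of_nat r) ((opE ^^ r) f)"
proof (induction r)
  case (Suc r)
  then show ?case by (simp add: opE_linear opE_W_mult smult_add_left algebra_simps)
qed (simp add: opT_def)

text \<open>\<open>T = W E\<close> is a number operator: moving it past \<open>W^p\<close> adds
  \<open>p\<close>, and moving it past \<open>E^r\<close> subtracts \<open>r\<close>.\<close>

lemma opT_W_power_opE_pow:
  "opT (W ^ p * (opE ^^ r) f) =
     W ^ p * (opE ^^ r) (opT f) + smult (of_nat p - of_nat r) (W ^ p * (opE ^^ r) f)"
proof -
  \<comment> \<open>For \<open>p = 0\<close> the truncated exponent is harmless because the
    coefficient is 0.\<close>
  have "W * smult (of_nat p) (W ^ (p - 1) * (opE ^^ r) f) = smult (of_nat p) (W ^ p * (opE ^^ r) f)"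
    by (cases p) (simp_all add: mult.assoc)
  then have "opT (W ^ p * (opE ^^ r) f) = W ^ p * (W * (opE ^^ Suc r) f) + smult (of_nat p) (W ^ p * (opE ^^ r) f)"
    by (simp add: opT_def[of "W ^ p * _"] opE_W_power_mult distrib_left mult.left_commute)
  then show ?thesis
    by (simp add: opE_pow_opT smult_diff_left distrib_left)
qed

lemma touchard_0 [simp]: "touchard r 0 = 1"
  by (induction r) (simp_all add: touchard_def opE_linear)

lemma touchard_Suc: "touchard r (Suc n) = W * touchard (Suc r) n + smult (of_nat r) (touchard r n)"
  using opE_pow_opT[of r "(opT ^^ n) 1"] by (simp add: touchard_def)

lemma opE_touchard: "opE (touchard r n) = touchard (Suc r) n"
  by (simp add: touchard_def)

lemma pderiv_touchard: "pderiv (touchard r n) = touchard (Suc r) n - touchard r n"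
  by (simp add: pderiv_eq opE_touchard)

section \<open>Basis functions and their finite spans\<close>

definition basis_fun :: "nat \<Rightarrow> nat \<Rightarrow> nat \<Rightarrow> nat \<Rightarrow> rat poly" where
  "basis_fun p r s n = smult (of_nat (n choose s)) (W ^ p * touchard r (n - s))"

text \<open>For \<open>s <= n\<close> this is the commutation relation of \<open>T\<close> with
  \<open>W^p E^r\<close>. For \<open>n < s\<close> the binomial coefficient vanishes, so the
  truncated \<open>n - s\<close> does no harm.\<close>

lemma opT_basis_fun:
  "opT (basis_fun p r s n) = smult (of_nat (n choose s)) (W ^ p * touchard r (Suc n - s)) +
     smult (of_nat p - of_nat r) (basis_fun p r s n)"
proof (cases "s \<le> n")
  case True
  then have "Suc n - s = Suc (n - s)" by simp
  then show ?thesis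
    by (simp add: basis_fun_def opT_linear touchard_def opT_W_power_opE_pow smult_add_right mult.commute)
next
  case False
  then show ?thesis by (simp add: basis_fun_def opT_linear binomial_eq_0)
qed

text \<open>Pascal's rule splits \<open>Suc n choose Suc s\<close>; the part with
  \<open>n choose Suc s\<close> is \<open>T\<close> of the old value, up to the shift by
  \<open>p - r\<close>.\<close>

lemma basis_fun_Suc:
  "basis_fun p r (Suc s) (Suc n) = opT (basis_fun p r (Suc s) n) + basis_fun p r s n -
     smult (of_nat p - of_nat r) (basis_fun p r (Suc s) n)"
  "basis_fun p r 0 (Suc n) = opT (basis_fun p r 0 n) - smult (of_nat p - of_nat r) (basis_fun p r 0 n)"
  unfolding opT_basis_fun by (simp_all add: basis_fun_def smult_add_left)

lemma opE_basis_fun: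
  "opE (basis_fun p r s n) = basis_fun p (Suc r) s n + smult (of_nat p) (basis_fun (p - 1) r s n)"
  by (simp add: basis_fun_def opE_linear opE_W_power_mult opE_touchard smult_add_right mult.commute)

text \<open>Generating the span one term at a time lets closure properties follow by induction. The
  bounds \<open>R\<close> and \<open>S\<close> later control the shifts of the Bell numbers and the
  degrees of their coefficients.\<close>

inductive opspan :: "nat \<Rightarrow> nat \<Rightarrow> nat \<Rightarrow> (nat \<Rightarrow> rat poly) \<Rightarrow> bool" for P R S where
  zero: "opspan P R S (\<lambda>_. 0)"
| step: "p \<le> P \<Longrightarrow> r \<le> R \<Longrightarrow> s \<le> S \<Longrightarrow> opspan P R S f \<Longrightarrow>
    opspan P R S (\<lambda>n. smult c (basis_fun p r s n) + f n)"

lemma opspan_basis: "p \<le> P \<Longrightarrow> r \<le> R \<Longrightarrow> s \<le> S \<Longrightarrow> opspan P R S (basis_fun p r s)"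
  using opspan.step[OF _ _ _ opspan.zero, of p P r R s S 1] by simp

lemma opspan_add:
  assumes "opspan P R S f" "opspan P R S g"
  shows "opspan P R S (\<lambda>n. f n + g n)"
  using assms(1)
proof induction
  case zero
  then show ?case using assms(2) by simp
next
  case (step p r s f c)
  then show ?case using opspan.step[OF step.hyps(1-3) step.IH, of c] by (simp add: add.assoc)
qed

lemma opspan_smult:
  assumes "opspan P R S f"
  shows "opspan P R S (\<lambda>n. smult c (f n))"
  using assms
proof induction
  case zero
  then show ?case using opspan.zero by simp
next
  case (step p r s f d)
  then show ?case using opspan.step[OF step.hyps(1-3) step.IH, of "c * d"] by (simp add: smult_add_right)
qed

lemma opspan_diff:
  assumes "opspan P R S f" "opspan P R S g"
  shows "opspan P R S (\<lambda>n. f n - g n)"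
  using opspan_add[OF assms(1) opspan_smult[OF assms(2), of "-1"]] by simp

lemma opspan_sum:
  assumes "\<And>x. x \<in> A \<Longrightarrow> opspan P R S (f x)"
  shows "opspan P R S (\<lambda>n. \<Sum>x\<in>A. f x n)"
  using assms by (induction A rule: infinite_finite_induct) (auto intro: opspan.zero opspan_add)

lemma opspan_mono:
  assumes "opspan P R S f" "P \<le> P'" "R \<le> R'" "S \<le> S'"
  shows "opspan P' R' S' f"
  using assms(1)
proof induction
  case (step p r s f c)
  then show ?case using assms(2-4) by (intro opspan.step) auto
qed (rule opspan.zero)

lemma opspan_W_mult:
  assumes "opspan P R S f"
  shows "opspan (Suc P) R S (\<lambda>n. W * f n)"
  using assms
proof induction
  case zero
  then show ?case using opspan.zero by simp
next
  case (step p r s f c)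
  then show ?case using opspan.step[of "Suc p" "Suc P" r R s S _ c]
    by (simp add: basis_fun_def distrib_left mult.assoc)
qed

lemma opspan_opE:
  assumes "opspan P R S f"
  shows "opspan P (Suc R) S (\<lambda>n. opE (f n))"
  using assms
proof induction
  case zero
  then show ?case using opspan.zero by (simp add: opE_linear)
next
  case (step p r s f c)
  \<comment> \<open>By the product rule \<open>opE\<close> turns one basis function into two, so the
    span is extended twice.\<close>
  then have "opspan P (Suc R) S (\<lambda>n. smult c (basis_fun p (Suc r) s n) + opE (f n))"
    by (intro opspan.step) auto
  moreover have "p - 1 \<le> P" "r \<le> Suc R" "s \<le> S" using step.hyps by auto
  ultimately have "opspan P (Suc R) S (\<lambda>n. smult (c * of_nat p) (basis_fun (p - 1) r s n) +
      (smult c (basis_fun p (Suc r) s n) + opE (f n)))"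
    by (rule opspan.step[rotated 3])
  then show ?case by (simp add: opE_linear opE_basis_fun smult_add_right add_ac)
qed

lemma opspan_pderiv_pow:
  assumes "opspan P R S f"
  shows "opspan P (R + j) S (\<lambda>n. (pderiv ^^ j) (f n))"
proof (induction j)
  case (Suc j)
  have "opspan P (Suc (R + j)) S (\<lambda>n. opE ((pderiv ^^ j) (f n)) - (pderiv ^^ j) (f n))"
    using opspan_diff[OF opspan_opE[OF Suc] opspan_mono[OF Suc]] by simp
  then show ?case by (simp add: opE_def)
qed (use assms in simp)

lemma monom_1_eq: "monom 1 j = (W - 1) ^ j"
proof (induction j)
  case (Suc j)
  then show ?case by (simp add: W_def monom_Suc one_pCons)
qed (simp add: monom_0 one_pCons)

lemma opspan_monom_mult:
  assumes "opspan P R S f"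
  shows "opspan (P + j) R S (\<lambda>n. monom 1 j * f n)"
proof (induction j)
  case (Suc j)
  have "opspan (Suc (P + j)) R S (\<lambda>n. W * (monom 1 j * f n) - monom 1 j * f n)"
    using opspan_diff[OF opspan_W_mult[OF Suc] opspan_mono[OF Suc]] by simp
  moreover have "monom 1 (Suc j) * g = W * (monom 1 j * g) - monom 1 j * g" for g
    by (simp add: monom_1_eq algebra_simps)
  ultimately show ?case by simp
qed (use assms in \<open>simp add: monom_0\<close>)

section \<open>Solving the inhomogeneous recurrence\<close>

text \<open>By \<open>basis_fun_Suc\<close> a basis function with \<open>p \<noteq> r\<close> is inverted by a division by \<open>p - r\<close>, up to
  a term with smaller \<open>s\<close>; only the resonant case \<open>p = r\<close> increases \<open>s\<close>.\<close>

lemma opspan_basis_antidifference: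
  assumes "p \<le> P" "r \<le> R" "s \<le> S"
  shows "\<exists>h. opspan P R (Suc S) h \<and> (\<forall>n. h (Suc n) = opT (h n) + basis_fun p r s n)"
proof (cases "p = r")
  case True
  then have "opspan P R (Suc S) (basis_fun p r (Suc s))" using assms by (intro opspan_basis) auto
  then show ?thesis using True basis_fun_Suc(1)[of p r s] by (intro exI[of _ "basis_fun p r (Suc s)"]) simp
next
  case False
  define c :: rat where "c = of_nat p - of_nat r"
  have c: "c \<noteq> 0" using False by (simp add: c_def)
  show ?thesis using assms(3)
  proof (induction s)
    case 0
    have "opspan P R (Suc S) (\<lambda>n. smult (- 1 / c) (basis_fun p r 0 n))"
      using assms by (intro opspan_smult opspan_basis) auto
    moreover have "smult (- 1 / c) (basis_fun p r 0 (Suc n)) =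
        opT (smult (- 1 / c) (basis_fun p r 0 n)) + basis_fun p r 0 n" for n
      using c by (simp add: basis_fun_Suc(2) opT_linear smult_diff_right c_def[symmetric])
    ultimately show ?case by blast
  next
    case (Suc s)
    then obtain h where h: "opspan P R (Suc S) h" "\<And>n. h (Suc n) = opT (h n) + basis_fun p r s n" by auto
    \<comment> \<open>The basis function with \<open>Suc s\<close> solves the recurrence with
      inhomogeneity \<open>b_s - c b_(s+1)\<close>, where \<open>b_s\<close> is the one with
      \<open>s\<close>. Subtracting \<open>h\<close> cancels \<open>b_s\<close>, and division by
      \<open>- c\<close> normalises the rest.\<close>
    have "opspan P R (Suc S) (\<lambda>n. smult (- 1 / c) (basis_fun p r (Suc s) n - h n))"
      using assms Suc.prems h(1) by (intro opspan_smult opspan_diff opspan_basis) auto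
    moreover have "smult (- 1 / c) (basis_fun p r (Suc s) (Suc n) - h (Suc n)) =
        opT (smult (- 1 / c) (basis_fun p r (Suc s) n - h n)) + basis_fun p r (Suc s) n" for n
      using c by (simp add: h(2) basis_fun_Suc(1) opT_linear smult_diff_right smult_add_right c_def[symmetric])
    ultimately show ?case by blast
  qed
qed

lemma opspan_antidifference:
  assumes "opspan P R S g"
  shows "\<exists>h. opspan P R (Suc S) h \<and> (\<forall>n. h (Suc n) = opT (h n) + g n)"
  using assms
proof induction
  case zero
  then show ?case using opspan.zero by (intro exI[of _ "\<lambda>_. 0"]) (simp add: opT_linear)
next
  case (step p r s f c)
  obtain h where h: "opspan P R (Suc S) h" "\<And>n. h (Suc n) = opT (h n) + f n" using step.IH by auto
  obtain h' where h': "opspan P R (Suc S) h'" "\<And>n. h' (Suc n) = opT (h' n) + basis_fun p r s n"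
    using opspan_basis_antidifference[OF step.hyps(1-3)] by auto
  have "opspan P R (Suc S) (\<lambda>n. smult c (h' n) + h n)"
    using h h' by (intro opspan_add opspan_smult)
  moreover have "smult c (h' (Suc n)) + h (Suc n) =
      opT (smult c (h' n) + h n) + (smult c (basis_fun p r s n) + f n)" for n
    by (simp add: h h' opT_linear smult_add_right)
  ultimately show ?case by blast
qed

text \<open>For \<open>p = r\<close> the shift in the commutation relation is zero, so
  \<open>T\<close> commutes with \<open>W^p E^p\<close>; moreover \<open>E^p\<close> fixes
  1.\<close>

lemma opT_pow_W_power: "(opT ^^ n) (W ^ p) = basis_fun p p 0 n"
proof (induction n)
  case 0
  then show ?case by (simp add: basis_fun_def)
next
  case (Suc n)
  then show ?case by (simp add: basis_fun_Suc(2))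
qed

text \<open>At \<open>n = 0\<close> only terms with \<open>s = 0\<close> survive, and each is a
  multiple of some \<open>W^p\<close>, whose orbit is \<open>basis_fun p p 0\<close>. There
  \<open>p\<close> also serves as the exponent of \<open>E\<close>, hence the common bound
  \<open>K\<close>.\<close>

lemma opspan_homogeneous:
  assumes "opspan K K S f"
  shows "opspan K K S (\<lambda>n. (opT ^^ n) (f 0))"
  using assms
proof induction
  case zero
  then show ?case using opspan.zero by (simp add: opT_pow_linear)
next
  case (step p r s f c)
  show ?case
  proof (cases s)
    case 0
    then have "basis_fun p r s 0 = W ^ p" by (simp add: basis_fun_def)
    then show ?thesis
      using opspan.step[OF step.hyps(1,1) _ step.IH, of 0 c] by (simp add: opT_pow_linear opT_pow_W_power)
  next
    case (Suc s')
    then have "basis_fun p r s 0 = 0" by (simp add: basis_fun_def)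
    then show ?thesis using step.IH by simp
  qed
qed

text \<open>From a particular solution one subtracts the homogeneous solution with the same initial
  value.\<close>

lemma opspan_recurrence:
  assumes g: "opspan K K S g" and f0: "f 0 = 0" and rec: "\<And>n. f (Suc n) = opT (f n) + g n"
  shows "opspan K K (Suc S) f"
proof -
  obtain h where h: "opspan K K (Suc S) h" "\<And>n. h (Suc n) = opT (h n) + g n"
    using opspan_antidifference[OF g] by auto
  have "f n = h n - (opT ^^ n) (h 0)" for n
    by (induction n) (simp_all add: f0 rec h(2) opT_linear)
  then have "f = (\<lambda>n. h n - (opT ^^ n) (h 0))" by auto
  then show ?thesis using opspan_diff[OF h(1) opspan_homogeneous[OF h(1)]] by simp
qed

text \<open>The term \<open>j = 0\<close> is the first derivative and combines with
  \<open>F k\<close> into \<open>opT (F k)\<close>; what is left involves only smaller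
  orders.\<close>

lemma moment_recurrence_split:
  fixes F :: "nat \<Rightarrow> rat poly"
  shows "W * (F k + (\<Sum>j\<le>k. smult (1 / fact (Suc j)) (monom 1 j * (pderiv ^^ Suc j) (F (k - j))))) =
    opT (F k) + (\<Sum>j=1..k. W * smult (1 / fact (Suc j)) (monom 1 j * (pderiv ^^ Suc j) (F (k - j))))"
proof -
  have "(\<Sum>j\<le>k. smult (1 / fact (Suc j)) (monom 1 j * (pderiv ^^ Suc j) (F (k - j)))) =
    pderiv (F k) + (\<Sum>j=1..k. smult (1 / fact (Suc j)) (monom 1 j * (pderiv ^^ Suc j) (F (k - j))))"
    unfolding atMost_atLeast0 by (subst sum.atLeast_Suc_atMost) (simp_all add: monom_0)
  then show ?thesis
    by (simp add: opT_def opE_def distrib_left sum_distrib_left add.assoc del: funpow.simps fact_Suc)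
qed

lemma opspan_hierarchy:
  fixes F :: "nat \<Rightarrow> nat \<Rightarrow> rat poly"
  assumes F0: "F 0 = touchard 0" and init: "\<And>k. k > 0 \<Longrightarrow> F k 0 = 0"
    and rec: "\<And>k n. F k (Suc n) = opT (F k n) +
      (\<Sum>j=1..k. W * smult (1 / fact (Suc j)) (monom 1 j * (pderiv ^^ Suc j) (F (k - j) n)))"
  shows "opspan (2 * k) (2 * k) k (F k)"
proof (induction k rule: less_induct)
  case (less k)
  show ?case
  proof (cases "k = 0")
    case True
    have "touchard 0 = basis_fun 0 0 0" by (auto simp: basis_fun_def)
    then show ?thesis using True by (simp add: opspan_basis F0)
  next
    case False
    have "opspan (2 * k) (2 * k) (k - 1) (\<lambda>n. W * smult (1 / fact (Suc j))
        (monom 1 j * (pderiv ^^ Suc j) (F (k - j) n)))" if j: "j \<in> {1..k}" for j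
    proof -
      let ?K = "2 * (k - j)"
      have "opspan ?K ?K (k - j) (F (k - j))" using j by (intro less.IH) auto
      then have "opspan (Suc (?K + j)) (?K + Suc j) (k - j) (\<lambda>n. W * smult (1 / fact (Suc j))
          (monom 1 j * (pderiv ^^ Suc j) (F (k - j) n)))"
        by (intro opspan_W_mult opspan_smult opspan_monom_mult opspan_pderiv_pow)
      \<comment> \<open>Both \<open>p\<close> and \<open>r\<close> are at most
        \<open>2 * (k - j) + j + 1\<close>, hence at most \<open>2 * k\<close> because
        \<open>j >= 1\<close>.\<close>
      then show ?thesis by (rule opspan_mono) (use j in auto)
    qed
    then have "opspan (2 * k) (2 * k) (k - 1) (\<lambda>n. \<Sum>j=1..k. W * smult (1 / fact (Suc j))
        (monom 1 j * (pderiv ^^ Suc j) (F (k - j) n)))"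
      by (rule opspan_sum)
    then have "opspan (2 * k) (2 * k) (Suc (k - 1)) (F k)"
      by (rule opspan_recurrence) (use False init rec in auto)
    then show ?thesis using False by simp
  qed
qed

section \<open>Evaluation at zero\<close>

lemma poly_touchard_0_expand:
  "\<exists>c. \<forall>m. poly (touchard r m) 0 = (\<Sum>i\<le>r. c i * poly (touchard 0 (m + i)) 0)"
proof (induction r)
  case 0
  then show ?case by (intro exI[of _ "\<lambda>_. 1"]) simp
next
  case (Suc r)
  then obtain c where c: "\<And>m. poly (touchard r m) 0 = (\<Sum>i\<le>r. c i * poly (touchard 0 (m + i)) 0)" by auto
  \<comment> \<open>The polynomial with coefficients \<open>c\<close> is multiplied by
    \<open>x - r\<close>, as in building up a falling factorial.\<close>
  define d where "d i = (if i = 0 then 0 else c (i - 1)) - (if i \<le> r then of_nat r * c i else 0)" for i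
  have "poly (touchard (Suc r) m) 0 = (\<Sum>i\<le>Suc r. d i * poly (touchard 0 (m + i)) 0)" for m
  proof -
    \<comment> \<open>This is \<open>touchard_Suc\<close> solved for its first term, since
      \<open>W\<close> has value 1 at 0.\<close>
    have "poly (touchard (Suc r) m) 0 = poly (touchard r (Suc m)) 0 - of_nat r * poly (touchard r m) 0"
      by (simp add: touchard_Suc)
    also have "\<dots> = (\<Sum>i\<le>r. c i * poly (touchard 0 (Suc m + i)) 0) -
        (\<Sum>i\<le>r. of_nat r * c i * poly (touchard 0 (m + i)) 0)"
      by (simp only: c sum_distrib_left mult.assoc)
    also have "(\<Sum>i\<le>r. c i * poly (touchard 0 (Suc m + i)) 0) =
        (\<Sum>i\<le>Suc r. (if i = 0 then 0 else c (i - 1)) * poly (touchard 0 (m + i)) 0)"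
      by (subst sum.atMost_Suc_shift) simp
    also have "(\<Sum>i\<le>r. of_nat r * c i * poly (touchard 0 (m + i)) 0) =
        (\<Sum>i\<le>Suc r. (if i \<le> r then of_nat r * c i else 0) * poly (touchard 0 (m + i)) 0)"
      by simp
    finally show ?thesis
      by (simp only: sum_subtractf[symmetric] d_def left_diff_distrib)
  qed
  then show ?case by blast
qed

lemma opspan_eval:
  assumes "opspan P R S f"
  shows "\<exists>a. \<forall>n. poly (f n) 0 =
    (\<Sum>s\<le>S. \<Sum>i\<le>R. a s i * of_nat (n choose s) * poly (touchard 0 (n - s + i)) 0)"
  using assms
proof induction
  case zero
  then show ?case by (intro exI[of _ "\<lambda>_ _. 0"]) simp
next
  case (step p r s f c)
  obtain a where a: "\<And>n. poly (f n) 0 =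
    (\<Sum>s\<le>S. \<Sum>i\<le>R. a s i * of_nat (n choose s) * poly (touchard 0 (n - s + i)) 0)" using step.IH by auto
  obtain d where d: "\<And>m. poly (touchard r m) 0 = (\<Sum>i\<le>r. d i * poly (touchard 0 (m + i)) 0)"
    using poly_touchard_0_expand by blast
  define b where "b t i = (if t = s then if i \<le> r then c * d i else 0 else 0)" for t i
  have "poly (smult c (basis_fun p r s n)) 0 =
      (\<Sum>t\<le>S. \<Sum>i\<le>R. b t i * of_nat (n choose t) * poly (touchard 0 (n - t + i)) 0)" for n
  proof -
    have "(\<Sum>t\<le>S. \<Sum>i\<le>R. b t i * of_nat (n choose t) * poly (touchard 0 (n - t + i)) 0) =
      (\<Sum>t\<le>S. if t = s then \<Sum>i\<le>R. (if i \<le> r then c * d i else 0) * of_nat (n choose s) * poly (touchard 0 (n - s + i)) 0 else 0)"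
      by (intro sum.cong) (auto simp: b_def)
    also have "\<dots> = (\<Sum>i\<le>R. (if i \<le> r then c * d i else 0) * of_nat (n choose s) * poly (touchard 0 (n - s + i)) 0)"
      using step.hyps(3) by simp
    also have "\<dots> = (\<Sum>i\<le>r. (if i \<le> r then c * d i else 0) * of_nat (n choose s) * poly (touchard 0 (n - s + i)) 0)"
      using step.hyps(2) by (intro sum.mono_neutral_right) auto
    also have "\<dots> = poly (smult c (basis_fun p r s n)) 0"
      by (simp add: basis_fun_def d sum_distrib_left mult_ac)
    finally show ?thesis by simp
  qed
  then have "poly (smult c (basis_fun p r s n) + f n) 0 =
      (\<Sum>t\<le>S. \<Sum>i\<le>R. (b t i + a t i) * of_nat (n choose t) * poly (touchard 0 (n - t + i)) 0)" for n
    by (simp only: poly_add a sum.distrib distrib_right)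
  then show ?case by (intro exI[of _ "\<lambda>t i. b t i + a t i"]) blast
qed

section \<open>Powers as sums of binomial coefficients, and polynomial coefficients\<close>

lemma power_eq_sum_choose: "\<exists>a. \<forall>x. (of_nat x :: rat) ^ k = (\<Sum>j\<le>k. a j * of_nat (x choose j))"
proof (induction k)
  case 0
  then show ?case by (intro exI[of _ "\<lambda>_. 1"]) simp
next
  case (Suc k)
  then obtain a where a: "\<And>x. (of_nat x :: rat) ^ k = (\<Sum>j\<le>k. a j * of_nat (x choose j))" by auto
  define d where "d j = (if j = 0 then 0 else a (j - 1) * of_nat j) + (if j \<le> k then a j * of_nat j else 0)" for j
  have "(of_nat x :: rat) ^ Suc k = (\<Sum>j\<le>Suc k. d j * of_nat (x choose j))" for x
  proof -
    \<comment> \<open>Writing the factor \<open>x\<close> as \<open>(x - j) + j\<close> gives the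
      recursion that \<open>d\<close> encodes.\<close>
    have absorb: "of_nat x * of_nat (x choose j) =
        (of_nat (Suc j) * of_nat (x choose Suc j) + of_nat j * of_nat (x choose j) :: rat)" for j
    proof -
      have "Suc j * (x choose Suc j) + j * (x choose j) = x * (x choose j)"
      proof (cases "j \<le> x")
        case True
        have "Suc j * (x choose Suc j) = (x - j) * (x choose j)"
          using binomial_absorb_comp[of x j] binomial_absorption[of j x] by simp
        then show ?thesis using True by (simp add: distrib_right[symmetric] del: binomial_Suc_Suc)
      qed (simp add: binomial_eq_0 del: binomial_Suc_Suc)
      then show ?thesis by (metis of_nat_add of_nat_mult)
    qed
    have "(of_nat x :: rat) ^ Suc k = (\<Sum>j\<le>k. a j * (of_nat x * of_nat (x choose j)))"
      by (simp add: a sum_distrib_left mult_ac)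
    also have "\<dots> = (\<Sum>j\<le>k. a j * of_nat (Suc j) * of_nat (x choose Suc j)) + (\<Sum>j\<le>k. a j * of_nat j * of_nat (x choose j))"
      by (simp only: absorb distrib_left sum.distrib mult.assoc)
    also have "(\<Sum>j\<le>k. a j * of_nat (Suc j) * of_nat (x choose Suc j)) =
        (\<Sum>j\<le>Suc k. (if j = 0 then 0 else a (j - 1) * of_nat j) * of_nat (x choose j))"
      by (subst sum.atMost_Suc_shift) (simp del: of_nat_Suc)
    also have "(\<Sum>j\<le>k. a j * of_nat j * of_nat (x choose j)) =
        (\<Sum>j\<le>Suc k. (if j \<le> k then a j * of_nat j else 0) * of_nat (x choose j))"
      by simp
    finally show ?thesis by (simp only: sum.distrib[symmetric] d_def distrib_right)
  qed
  then show ?case by blast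
qed

lemma binomial_poly:
  "\<exists>q :: rat poly. degree q \<le> s \<and> (\<forall>n. poly q (of_nat n) = of_nat (n choose s))"
proof -
  define q :: "rat poly" where "q = smult (1 / fact s) (\<Prod>i=0..<s. [:- of_nat i, 1:])"
  have "degree (\<Prod>i=0..<s. [:- of_nat i, 1 :: rat:]) \<le> (\<Sum>i=0..<s. degree [:- of_nat i, 1 :: rat:])"
    using degree_prod_sum_le[of "{0..<s}" "\<lambda>i. [:- of_nat i, 1 :: rat:]"] by (simp add: o_def)
  then have "degree q \<le> s" by (simp add: q_def)
  moreover have "poly q (of_nat n) = of_nat (n choose s)" for n
    by (simp add: q_def poly_prod binomial_gbinomial gbinomial_prod_rev)
  ultimately show ?thesis by blast
qed

text \<open>Terms are collected by the shift \<open>d = i - s\<close>. Since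
  \<open>i <= 2 * k\<close>, the degree is at most \<open>s = i - d <= 2 * k - d\<close>.\<close>

lemma bell_polynomial_form:
  fixes b m :: "nat \<Rightarrow> rat" and a :: "nat \<Rightarrow> nat \<Rightarrow> rat"
  assumes m: "\<And>n. m n = (\<Sum>s\<le>k. \<Sum>i\<le>2*k. a s i * of_nat (n choose s) * b (n - s + i))"
  shows "\<exists>Q :: int \<Rightarrow> rat poly.
            (\<forall>j::nat. j \<le> 3 * k \<longrightarrow> degree (Q (2 * int k - int j)) \<le> j) \<and>
            (\<forall>n::nat. n \<ge> k \<longrightarrow>
               m n = (\<Sum>j\<in>{- int k..2 * int k}. poly (Q j) (of_nat n) * b (nat (int n + j))))"
proof -
  obtain q :: "nat \<Rightarrow> rat poly" where q: "\<And>s. degree (q s) \<le> s" "\<And>s n. poly (q s) (of_nat n) = of_nat (n choose s)"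
    using binomial_poly by metis
  define Q where "Q d = (\<Sum>s\<le>k. \<Sum>i\<le>2*k. if d = int i - int s then smult (a s i) (q s) else 0)" for d
  have "degree (Q (2 * int k - int j)) \<le> j" for j
    unfolding Q_def
  proof (intro degree_sum_le)
    fix s i assume "s \<in> {..k}" "i \<in> {..2*k}"
    then show "degree (if 2 * int k - int j = int i - int s then smult (a s i) (q s) else 0) \<le> j"
      using q(1)[of s] degree_smult_le[of "a s i" "q s"] by auto
  qed auto
  moreover have "m n = (\<Sum>j\<in>{- int k..2 * int k}. poly (Q j) (of_nat n) * b (nat (int n + j)))" if n: "n \<ge> k" for n
  proof -
    have "(\<Sum>j\<in>{- int k..2 * int k}. poly (Q j) (of_nat n) * b (nat (int n + j))) =
      (\<Sum>j\<in>{- int k..2 * int k}. \<Sum>s\<le>k. \<Sum>i\<le>2*k.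
         (if j = int i - int s then a s i * of_nat (n choose s) * b (nat (int n + j)) else 0))"
      by (simp add: Q_def poly_sum sum_distrib_right q if_distrib[of "\<lambda>p. poly p _"] if_distrib[of "\<lambda>x. x * _"] cong: if_cong)
    also have "\<dots> = (\<Sum>s\<le>k. \<Sum>i\<le>2*k. \<Sum>j\<in>{- int k..2 * int k}.
         (if j = int i - int s then a s i * of_nat (n choose s) * b (nat (int n + j)) else 0))"
      by (subst sum.swap, intro sum.cong refl, rule sum.swap)
    also have "\<dots> = (\<Sum>s\<le>k. \<Sum>i\<le>2*k. a s i * of_nat (n choose s) * b (n - s + i))"
    proof (intro sum.cong refl)
      fix s i assume s: "s \<in> {..k}" and i: "i \<in> {..2*k}"
      \<comment> \<open>As \<open>s <= k <= n\<close>, the subtraction \<open>n - s\<close> is not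
        truncated.\<close>
      have "nat (int n + (int i - int s)) = n - s + i" using s n by auto
      moreover have "int i - int s \<in> {- int k..2 * int k}" using s i by auto
      ultimately show "(\<Sum>j\<in>{- int k..2 * int k}.
         (if j = int i - int s then a s i * of_nat (n choose s) * b (nat (int n + j)) else 0)) =
         a s i * of_nat (n choose s) * b (n - s + i)"
        by (simp add: sum.delta)
    qed
    finally show ?thesis by (simp add: m)
  qed
  ultimately show ?thesis by blast
qed

section \<open>Moments of the intertwining exponent\<close>

lemma moment_poly_step:
  "moment_poly k (Suc n) = opT (moment_poly k n) +
    (\<Sum>j=1..k. W * smult (1 / fact (Suc j)) (monom 1 j * (pderiv ^^ Suc j) (moment_poly (k - j) n)))"
  using moment_recurrence_split[of "\<lambda>k. moment_poly k n" k] by (simp only: moment_poly_Suc W_def)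

text \<open>For order 0 the sum over \<open>j\<close> is empty, so both sequences start at 1 and
  iterate \<open>opT\<close>.\<close>

lemma moment_poly_0_eq: "moment_poly 0 = touchard 0"
proof
  show "moment_poly 0 n = touchard 0 n" for n
    by (induction n) (simp_all add: moment_poly_0 moment_poly_step touchard_def)
qed

lemma poly_touchard_0_0: "poly (touchard 0 n) 0 = of_nat (bell n)"
  using poly_moment_poly_0[of 0 n] by (simp add: moment_poly_0_eq bell_def)

lemma poly_touchard_Suc_0:
  "poly (touchard (Suc r) n) 0 = poly (touchard r (Suc n)) 0 - of_nat r * poly (touchard r n) 0"
  by (simp add: touchard_Suc)

lemma opspan_moment_poly: "opspan (2 * k) (2 * k) k (moment_poly k)"
  by (rule opspan_hierarchy) (simp_all only: moment_poly_0_eq moment_poly_0 moment_poly_step if_False neq0_conv[symmetric])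

text \<open>A power of the exponent is a combination of binomial coefficients of order at most
  \<open>k\<close>, whose moment polynomials all lie in the span for \<open>k\<close>.\<close>

lemma intertwining_moment_expand:
  "\<exists>a. \<forall>n. of_nat (intertwining_moment k n) =
    (\<Sum>s\<le>k. \<Sum>i\<le>2*k. a s i * of_nat (n choose s) * (of_nat (bell (n - s + i)) :: rat))"
proof -
  obtain c :: "nat \<Rightarrow> rat" where c: "\<And>x. of_nat x ^ k = (\<Sum>j\<le>k. c j * of_nat (x choose j))"
    using power_eq_sum_choose by blast
  define f where "f n = (\<Sum>j\<le>k. smult (c j) (moment_poly j n))" for n
  have "opspan (2 * k) (2 * k) k f"
    unfolding f_def by (intro opspan_sum opspan_smult opspan_mono[OF opspan_moment_poly]) auto
  then obtain a where "\<And>n. poly (f n) 0 =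
      (\<Sum>s\<le>k. \<Sum>i\<le>2*k. a s i * of_nat (n choose s) * poly (touchard 0 (n - s + i)) 0)"
    using opspan_eval by blast
  moreover have "of_nat (intertwining_moment k n) = poly (f n) 0" for n
  proof -
    have "of_nat (intertwining_moment k n) =
        (\<Sum>P\<in>set_partitions n. \<Sum>j\<le>k. c j * of_nat (intertwining P choose j))"
      by (simp add: intertwining_moment_def c)
    also have "\<dots> = (\<Sum>j\<le>k. \<Sum>P\<in>set_partitions n. c j * of_nat (intertwining P choose j))"
      by (rule sum.swap)
    finally show ?thesis
      by (simp add: f_def poly_sum poly_moment_poly_0 sum_distrib_left)
  qed
  ultimately show ?thesis by (auto simp: poly_touchard_0_0)
qed

section \<open>Explicit first and second moments\<close>

lemma touchard_Suc_of_nat: "touchard r (Suc n) = W * touchard (Suc r) n + of_nat r * touchard r n"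
  by (simp add: touchard_Suc of_nat_poly)

lemma pderiv_W_power: "pderiv (W ^ k) = of_nat k * W ^ (k - 1)"
  by (cases k) (simp_all add: pderiv_power_Suc of_nat_poly del: power_Suc of_nat_Suc)

lemma pderiv_of_nat_power: "pderiv (of_nat n ^ k :: rat poly) = 0"
  by (simp add: pderiv_of_nat flip: of_nat_power)

text \<open>The coefficients below come from carrying out the inversion behind \<open>opspan_recurrence\<close> explicitly.\<close>

lemma moment_poly_1_explicit:
  "4 * moment_poly 1 n = 2 * of_nat n * W * touchard 1 n + 2 * of_nat n * touchard 0 n - 3 * W ^ 2 * touchard 2 n
      + 4 * W ^ 2 * touchard 1 n - W ^ 2 * touchard 0 n - 2 * W * touchard 2 n + 2 * W * touchard 0 n" (is "_ = ?R n")
proof (induction n)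
  case 0
  then show ?case by (simp add: moment_poly_0)
next
  case (Suc n)
  have rec: "moment_poly 1 (Suc n) = opT (moment_poly 1 n) +
      W * smult (1 / 2) ((W - 1) * pderiv (pderiv (touchard 0 n)))"
    using moment_poly_step[of 1 n] by (simp add: monom_1_eq moment_poly_0_eq)
  have half: "4 * smult (1 / 2) f = 2 * f" for f :: "rat poly"
    by (simp add: numeral_poly)
  have "4 * moment_poly 1 (Suc n) = W * (4 * moment_poly 1 n + pderiv (4 * moment_poly 1 n)) + W * (4 * smult (1 / 2) ((W - 1) * pderiv (pderiv (touchard 0 n))))"
    unfolding rec by (simp add: opT_def opE_def pderiv_mult distrib_left mult_ac)
  also have "\<dots> = W * (?R n + pderiv (?R n)) + W * (2 * ((W - 1) * pderiv (pderiv (touchard 0 n))))"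
    by (simp only: Suc half)
  also have "\<dots> = ?R (Suc n)"
    \<comment> \<open>After rewriting, only \<open>W\<close>, \<open>of_nat n\<close> and the
      \<open>touchard r n\<close> remain; \<open>algebra\<close> then checks a polynomial identity
      in them with integer coefficients.\<close>
    by (simp add: pderiv_add pderiv_diff pderiv_mult pderiv_W_power pderiv_of_nat_power pderiv_touchard touchard_Suc_of_nat
      flip: numeral_2_eq_2) algebra
  finally show ?case .
qed

lemma moment_poly_2_explicit:
  "288 * moment_poly 2 n = 36 * of_nat n ^ 2 * W ^ 2 * touchard 2 n + 108 * of_nat n ^ 2 * W * touchard 1 n
      + 36 * of_nat n ^ 2 * touchard 0 n - 108 * of_nat n * W ^ 3 * touchard 3 n
      + 144 * of_nat n * W ^ 3 * touchard 2 n - 36 * of_nat n * W ^ 3 * touchard 1 n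
      - 72 * of_nat n * W ^ 2 * touchard 3 n - 312 * of_nat n * W ^ 2 * touchard 2 n
      + 360 * of_nat n * W ^ 2 * touchard 1 n - 36 * of_nat n * W ^ 2 * touchard 0 n
      - 216 * of_nat n * W * touchard 2 n - 348 * of_nat n * W * touchard 1 n
      + 72 * of_nat n * W * touchard 0 n - 84 * of_nat n * touchard 0 n + 81 * W ^ 4 * touchard 4 n
      - 216 * W ^ 4 * touchard 3 n + 198 * W ^ 4 * touchard 2 n - 72 * W ^ 4 * touchard 1 n
      + 9 * W ^ 4 * touchard 0 n + 108 * W ^ 3 * touchard 4 n + 176 * W ^ 3 * touchard 3 n
      - 648 * W ^ 3 * touchard 2 n + 432 * W ^ 3 * touchard 1 n - 68 * W ^ 3 * touchard 0 n
      + 36 * W ^ 2 * touchard 4 n + 480 * W ^ 2 * touchard 3 n - 108 * W ^ 2 * touchard 2 n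
      - 576 * W ^ 2 * touchard 1 n + 168 * W ^ 2 * touchard 0 n + 96 * W * touchard 3 n
      + 360 * W * touchard 2 n - 288 * W * touchard 1 n - 168 * W * touchard 0 n" (is "_ = ?R n")
proof (induction n)
  case 0
  then show ?case by (simp add: moment_poly_0)
next
  case (Suc n)
  \<comment> \<open>The fractions are \<open>1 / fact 2\<close> and \<open>1 / fact 3\<close>, for
    \<open>j = 1\<close> and \<open>j = 2\<close>.\<close>
  have rec: "moment_poly 2 (Suc n) = opT (moment_poly 2 n) +
      W * smult (1 / 2) ((W - 1) * pderiv (pderiv (moment_poly 1 n))) +
      W * smult (1 / 6) ((W - 1) ^ 2 * pderiv (pderiv (pderiv (touchard 0 n))))"
  proof -
    have "{1..2::nat} = {1, 2}" by auto
    moreover have "fact 3 = (6::rat)" by (simp add: fact_numeral)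
    ultimately show ?thesis
      using moment_poly_step[of 2 n] by (simp add: monom_1_eq moment_poly_0_eq numeral_2_eq_2 numeral_3_eq_3)
  qed
  have c: "288 * smult (1 / 2) f = 144 * f" "288 * smult (1 / 6) f = 48 * f" for f :: "rat poly"
    by (simp_all add: numeral_poly)
  have "288 * moment_poly 2 (Suc n) = W * (288 * moment_poly 2 n + pderiv (288 * moment_poly 2 n)) + W * (288 * smult (1 / 2) ((W - 1) * pderiv (pderiv (moment_poly 1 n)))) +
    W * (288 * smult (1 / 6) ((W - 1) ^ 2 * pderiv (pderiv (pderiv (touchard 0 n)))))"
    unfolding rec by (simp add: opT_def opE_def pderiv_mult distrib_left mult_ac)
  \<comment> \<open>Here 144 is split as \<open>36 * 4\<close>, so that the formula for
    \<open>4 * moment_poly 1 n\<close> can be inserted.\<close>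
  also have "\<dots> = W * (?R n + pderiv (?R n)) + W * (36 * ((W - 1) * pderiv (pderiv (4 * moment_poly 1 n)))) +
     W * (48 * ((W - 1) ^ 2 * pderiv (pderiv (pderiv (touchard 0 n)))))"
    unfolding c Suc by (simp add: pderiv_mult pderiv_add)
  also have "\<dots> = ?R (Suc n)"
    unfolding moment_poly_1_explicit
    by (simp add: pderiv_add pderiv_diff pderiv_mult pderiv_W_power pderiv_of_nat_power pderiv_touchard touchard_Suc_of_nat
      flip: numeral_2_eq_2) algebra
  finally show ?case .
qed

text \<open>The coefficients are those of \<open>x (x - 1) ... (x - r + 1)\<close>, with
  \<open>x^i\<close> replaced by the Bell number of index \<open>n + i\<close>.\<close>

lemma poly_touchard_numeral_0:
  "poly (touchard 1 n) 0 = of_nat (bell (n + 1))"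
  "poly (touchard 2 n) 0 = of_nat (bell (n + 2)) - of_nat (bell (n + 1))"
  "poly (touchard 3 n) 0 = of_nat (bell (n + 3)) - 3 * of_nat (bell (n + 2)) + 2 * of_nat (bell (n + 1))"
  "poly (touchard 4 n) 0 = of_nat (bell (n + 4)) - 6 * of_nat (bell (n + 3)) + 11 * of_nat (bell (n + 2))
     - 6 * of_nat (bell (n + 1))"
  by (simp_all add: eval_nat_numeral poly_touchard_Suc_0 poly_touchard_0_0 algebra_simps)

lemma intertwining_moment_1:
  "(of_nat (intertwining_moment 1 n) :: rat) =
      1 / 4 * ((2 * of_nat n + 1) * of_nat (bell n)
             + (2 * of_nat n + 9) * of_nat (bell (n + 1))
             - 5 * of_nat (bell (n + 2)))"
proof -
  have "of_nat (intertwining_moment 1 n) = poly (moment_poly 1 n) 0"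
    by (simp add: intertwining_moment_def poly_moment_poly_0)
  moreover have "4 * poly (moment_poly 1 n) 0 = poly (4 * moment_poly 1 n) 0" by simp
  ultimately have "4 * of_nat (intertwining_moment 1 n) = poly (4 * moment_poly 1 n) 0" by simp
  also have "\<dots> = (2 * of_nat n + 1) * of_nat (bell n)
             + (2 * of_nat n + 9) * of_nat (bell (n + 1))
             - 5 * of_nat (bell (n + 2))"
    unfolding moment_poly_1_explicit
    by (simp only: poly_add poly_diff poly_mult poly_power poly_W_0 poly_of_nat poly_numeral
        poly_touchard_0_0 poly_touchard_numeral_0) (simp add: algebra_simps)
  finally show ?thesis by simp
qed

lemma intertwining_moment_2:
  "(of_nat (intertwining_moment 2 n) :: rat) =
      1 / 144 * ((36 * of_nat n ^ 2 + 24 * of_nat n - 23) * of_nat (bell n)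
               + (72 * of_nat n ^ 2 + 72 * of_nat n - 260) * of_nat (bell (n + 1))
               + (36 * of_nat n ^ 2 + 156 * of_nat n + 489) * of_nat (bell (n + 2))
               - (180 * of_nat n + 814) * of_nat (bell (n + 3))
               + 225 * of_nat (bell (n + 4)))"
proof -
  \<comment> \<open>This reduces the second moment to twice the second binomial moment plus the
    first moment.\<close>
  have "x ^ 2 = 2 * (x choose 2) + x" for x :: nat
    by (induction x) (simp_all add: eval_nat_numeral)
  then have "of_nat (intertwining_moment 2 n) = (2 * poly (moment_poly 2 n) 0 + of_nat (intertwining_moment 1 n) :: rat)"
    by (simp add: intertwining_moment_def poly_moment_poly_0 sum.distrib sum_distrib_left)
  moreover have "288 * poly (moment_poly 2 n) 0 = poly (288 * moment_poly 2 n) 0" by simp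
  ultimately have "144 * of_nat (intertwining_moment 2 n) =
      poly (288 * moment_poly 2 n) 0 + 144 * of_nat (intertwining_moment 1 n)" by simp
  also have "\<dots> = (36 * of_nat n ^ 2 + 24 * of_nat n - 23) * of_nat (bell n)
               + (72 * of_nat n ^ 2 + 72 * of_nat n - 260) * of_nat (bell (n + 1))
               + (36 * of_nat n ^ 2 + 156 * of_nat n + 489) * of_nat (bell (n + 2))
               - (180 * of_nat n + 814) * of_nat (bell (n + 3))
               + 225 * of_nat (bell (n + 4))"
    unfolding moment_poly_2_explicit intertwining_moment_1
    by (simp only: poly_add poly_diff poly_mult poly_power poly_W_0 poly_of_nat poly_numeral
        poly_touchard_0_0 poly_touchard_numeral_0) (simp add: algebra_simps)
  finally show ?thesis by simp
qed

theorem theorem3p4: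
  shows "(\<forall>k::nat. \<exists>Q :: int \<Rightarrow> rat poly.
            (\<forall>j::nat. j \<le> 3 * k \<longrightarrow> degree (Q (2 * int k - int j)) \<le> j) \<and>
            (\<forall>n::nat. n \<ge> k \<longrightarrow>
               of_nat (intertwining_moment k n) =
               (\<Sum>j\<in>{- int k..2 * int k}.
                  poly (Q j) (of_nat n) * of_nat (bell (nat (int n + j))))))
       \<and> (\<forall>n::nat. (of_nat (intertwining_moment 1 n) :: rat) =
            1 / 4 * ((2 * of_nat n + 1) * of_nat (bell n)
                   + (2 * of_nat n + 9) * of_nat (bell (n + 1))
                   - 5 * of_nat (bell (n + 2))))
       \<and> (\<forall>n::nat. (of_nat (intertwining_moment 2 n) :: rat) =
            1 / 144 * ((36 * of_nat n ^ 2 + 24 * of_nat n - 23) * of_nat (bell n)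
                     + (72 * of_nat n ^ 2 + 72 * of_nat n - 260) * of_nat (bell (n + 1))
                     + (36 * of_nat n ^ 2 + 156 * of_nat n + 489) * of_nat (bell (n + 2))
                     - (180 * of_nat n + 814) * of_nat (bell (n + 3))
                     + 225 * of_nat (bell (n + 4))))"
proof (intro conjI allI)
  fix k :: nat
  obtain a where "\<And>n. of_nat (intertwining_moment k n) =
      (\<Sum>s\<le>k. \<Sum>i\<le>2*k. a s i * of_nat (n choose s) * (of_nat (bell (n - s + i)) :: rat))"
    using intertwining_moment_expand by blast
  then show "\<exists>Q :: int \<Rightarrow> rat poly.
      (\<forall>j::nat. j \<le> 3 * k \<longrightarrow> degree (Q (2 * int k - int j)) \<le> j) \<and>
      (\<forall>n::nat. n \<ge> k \<longrightarrow>
         of_nat (intertwining_moment k n) =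
         (\<Sum>j\<in>{- int k..2 * int k}.
            poly (Q j) (of_nat n) * of_nat (bell (nat (int n + j)))))"
    by (rule bell_polynomial_form)
qed (rule intertwining_moment_1 intertwining_moment_2)+

end
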